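(* Let $m\ge1$. The linear operator $\mathcal{R}^m:U_h^0\to U_h^m$ is full-rank, i.e. $\dim(U_h^m)=\dim(U_h^0)$, where $U_h^m:=\mathcal{R}^mU_h^0$.
   Context: $\Omega\subset\mathbb{R}^d$ ($d=2,3$) is a bounded convex polygonal (polyhedral) domain with a quasi-uniform triangulation $\mathcal{T}_h$ into simplices (quasi-uniform: the maximal element diameter $h$ satisfies $h\le C_\sigma\rho$, where $\rho$ is the smallest inscribed-ball radius over all elements and $C_\sigma>0$ is fixed). $\boldsymbol{x}_K$ is the barycenter of $K\in\mathcal{T}_h$. $\mathbb{P}_m(D)$ is the space of polynomials of total degree at most $m$ on $D$. Fix an integer threshold $\#S$. For $K\in\mathcal{T}_h$ let $\Delta(K)=\{K'\in\mathcal{T}_h:\overline K\cap\overline{K'}\ne\varnothing\}$, $S_0(K)=\{K\}$, $S_t(K)=\bigcup_{K'\in S_{t-1}(K)}\Delta(K')$ for $t\ge1$, and let $S(K)=S_t(K)$ for the first $t$ such that the number of elements of $S_t(K)$ is at least $\#S$; $S(K)$ also denotes the region covered by its elements. Let $I(K)=\{\boldsymbol{x}_{K'}:K'\in S(K)\}$. Standing assumption: for every $K\in\mathcal{T}_h$, if $p\in\mathbb{P}_m(S(K))$ vanishes at all points of $I(K)$, then $p=0$. $U_h^0$ is the space of functions constant on each element of $\mathcal{T}_h$. For $v_h\in U_h^0$ and $K\in\mathcal{T}_h$, $\mathcal{R}_K^mv_h\in\mathbb{P}_m(S(K))$ is the unique minimizer of $\sum_{\boldsymbol{x}\in I(K)}(p(\boldsymbol{x})-v_h(\boldsymbol{x}))^2$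 over $p\in\mathbb{P}_m(S(K))$ subject to the constraint $p(\boldsymbol{x}_K)=v_h(\boldsymbol{x}_K)$; it depends linearly on $v_h$. The operator $\mathcal{R}^m$ is defined elementwise by $(\mathcal{R}^mv_h)|_K=(\mathcal{R}_K^mv_h)|_K$ for all $K\in\mathcal{T}_h$. *)

theory Defs
  imports "HOL-Analysis.Analysis" "HOL-Library.Function_Algebras"
begin

definition fscale :: "real \<Rightarrow> ('a \<Rightarrow> real) \<Rightarrow> 'a \<Rightarrow> real" where
  "fscale c f = (\<lambda>x. c * f x)"

interpretation fun_space: vector_space "fscale :: real \<Rightarrow> ('a \<Rightarrow> real) \<Rightarrow> 'a \<Rightarrow> real"
  by unfold_locales (auto simp: fscale_def fun_eq_iff algebra_simps)

definition convex_polyhedral_domain :: "'a::euclidean_space set \<Rightarrow> bool" where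
  "convex_polyhedral_domain \<Omega> \<longleftrightarrow>
     open \<Omega> \<and> \<Omega> \<noteq> {} \<and> bounded \<Omega> \<and> convex \<Omega> \<and> polyhedron (closure \<Omega>)"

(* The elements of a mesh are closed simplices, as in the library notion of triangulation. *)
definition simplicial_mesh :: "'a::euclidean_space set \<Rightarrow> 'a set set \<Rightarrow> bool" where
  "simplicial_mesh \<Omega> T \<longleftrightarrow>
     triangulation T \<and> (\<forall>K\<in>T. int DIM('a) simplex K) \<and> \<Union>T = closure \<Omega>"

definition mesh_size :: "'a::euclidean_space set set \<Rightarrow> real" where
  "mesh_size T = Max (diameter ` T)"

definition inradius :: "'a::euclidean_space set \<Rightarrow> real" where
  "inradius K = Sup {r. 0 < r \<and> (\<exists>x. ball x r \<subseteq> K)}"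

definition quasi_uniform :: "real \<Rightarrow> 'a::euclidean_space set set \<Rightarrow> bool" where
  "quasi_uniform C T \<longleftrightarrow> mesh_size T \<le> C * Min (inradius ` T)"

(* The extreme points of a simplex are its vertices. *)
definition barycenter :: "'a::euclidean_space set \<Rightarrow> 'a" where
  "barycenter K =
     (\<Sum>v | v extreme_point_of K. v) /\<^sub>R real (card {v. v extreme_point_of K})"

definition neighbours :: "'a set set \<Rightarrow> 'a set \<Rightarrow> 'a set set" where
  "neighbours T K = {K' \<in> T. K \<inter> K' \<noteq> {}}"

primrec layers :: "'a set set \<Rightarrow> 'a set \<Rightarrow> nat \<Rightarrow> 'a set set" where
  "layers T K 0 = {K}"
| "layers T K (Suc t) = (\<Union>K'\<in>layers T K t. neighbours T K')"

(* N is the threshold; this is meaningful only if some layer reaches it. *)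
definition patch :: "'a set set \<Rightarrow> int \<Rightarrow> 'a set \<Rightarrow> 'a set set" where
  "patch T N K = layers T K (LEAST t. N \<le> int (card (layers T K t)))"

definition sample_points :: "'a::euclidean_space set set \<Rightarrow> int \<Rightarrow> 'a set \<Rightarrow> 'a set" where
  "sample_points T N K = barycenter ` patch T N K"

(* Functions on a set D are represented by functions on the whole space that vanish
   outside D, so that equality of functions is equality on D. *)
definition polys_on :: "nat \<Rightarrow> (real ^ 'd) set \<Rightarrow> (real ^ 'd \<Rightarrow> real) set" where
  "polys_on m D =
     {p. \<exists>c :: ('d \<Rightarrow> nat) \<Rightarrow> real. p = (\<lambda>x. if x \<in> D
        then \<Sum>\<alpha> | (\<Sum>i\<in>UNIV. \<alpha> i) \<le> m. c \<alpha> * (\<Prod>i\<in>UNIV. (x $ i) ^ \<alpha> i) else 0)}"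

(* Piecewise constant functions live on the union of the element interiors: they may jump
   across faces, where no value is prescribed (0 in this representation). *)
definition pw_const :: "'a::euclidean_space set set \<Rightarrow> ('a \<Rightarrow> real) set" where
  "pw_const T = {v. (\<forall>K\<in>T. v constant_on interior K) \<and>
                    (\<forall>x. x \<notin> (\<Union>K\<in>T. interior K) \<longrightarrow> v x = 0)}"

definition local_recon ::
  "(real ^ 'd) set set \<Rightarrow> int \<Rightarrow> nat \<Rightarrow> (real ^ 'd) set \<Rightarrow> (real ^ 'd \<Rightarrow> real) \<Rightarrow> real ^ 'd \<Rightarrow> real"
  where
  "local_recon T N m K v =
     (THE p. is_arg_min (\<lambda>q. \<Sum>x\<in>sample_points T N K. (q x - v x)\<^sup>2)
               (\<lambda>q. q \<in> polys_on m (\<Union>(patch T N K)) \<and> q (barycenter K) = v (barycenter K)) p)"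

definition recon ::
  "(real ^ 'd) set set \<Rightarrow> int \<Rightarrow> nat \<Rightarrow> (real ^ 'd \<Rightarrow> real) \<Rightarrow> real ^ 'd \<Rightarrow> real" where
  "recon T N m v = (\<lambda>x. if x \<in> (\<Union>K\<in>T. interior K)
     then local_recon T N m (THE K. K \<in> T \<and> x \<in> interior K) v x else 0)"

end

theory Submission
  imports Defs
begin

text \<open>
  Each local reconstruction interpolates at its own barycenter: the constrained minimizer on the
  patch of K takes the value of v at the barycenter of K. An element is a full-dimensional simplex,
  so its barycenter is interior to it, and a piecewise constant function is determined by its values
  at the barycenters. Hence a piecewise constant function can be read off its reconstruction, and
  the reconstruction operator is injective on the piecewise constants; an injective linear map
  preserves dimension.

  What needs work is linearity, because the local reconstruction is given as the minimizer of a
  quadratic functional. A polynomial is that minimizer exactly when it satisfies the constraint and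
  its residual is orthogonal, in the sampled inner product, to all polynomials vanishing at the
  barycenter (\<open>lsq_normal_equations\<close>). Solutions exist by orthogonal projection
  (\<open>sampled_projection_exists\<close>), they are the unique minimizers because samples determine
  polynomials (\<open>the_arg_min_eq_solution\<close>), and the normal equations are visibly linear in
  the data. All of this works for arbitrary data v, piecewise constant or not, so the operator
  is linear on the space of all functions and the theory of linear maps between vector spaces applies to it directly.
\<close>

section \<open>Constrained least squares on a finite set of sample points\<close>

lemma fscale_apply: "fscale c f x = c * f x"
  by (simp add: fscale_def)

text \<open>
  The sampled inner product is only semidefinite on functions, so this is Gram--Schmidt with
  one extra case: a new direction whose orthogonal part is invisible to the samples needs no
  correction at all.
\<close>

lemma sampled_projection_exists:
  fixes f :: "'a \<Rightarrow> real"
  assumes "finite S" "finite B"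
  shows "\<exists>w\<in>fun_space.span B. \<forall>b\<in>fun_space.span B. (\<Sum>x\<in>S. (f x - w x) * b x) = 0"
  using assms(2)
proof (induction B arbitrary: f)
  case empty
  show ?case by simp
next
  case (insert a B)
  obtain w where w: "w \<in> fun_space.span B"
    and w_orth: "\<And>b. b \<in> fun_space.span B \<Longrightarrow> (\<Sum>x\<in>S. (f x - w x) * b x) = 0"
    using insert.IH[of f] by blast
  obtain u where u: "u \<in> fun_space.span B"
    and u_orth: "\<And>b. b \<in> fun_space.span B \<Longrightarrow> (\<Sum>x\<in>S. (a x - u x) * b x) = 0"
    using insert.IH[of a] by blast
  define e where "e = a - u"
  define c where "c = (\<Sum>x\<in>S. (f x - w x) * e x) / (\<Sum>x\<in>S. e x * e x)"
  have sub: "fun_space.span B \<subseteq> fun_space.span (insert a B)"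
    by (intro fun_space.span_mono) auto
  have e_span: "e \<in> fun_space.span (insert a B)"
    unfolding e_def using u sub by (blast intro: fun_space.span_diff fun_space.span_base)
  have c_eq: "(\<Sum>x\<in>S. (f x - w x) * e x) = c * (\<Sum>x\<in>S. e x * e x)"
  proof (cases "(\<Sum>x\<in>S. e x * e x) = 0")
    case True
    then have "\<forall>x\<in>S. e x = 0"
      using assms(1) by (simp add: sum_nonneg_eq_0_iff)
    then show ?thesis using True by simp
  qed (simp add: c_def)
  show ?case
  proof (intro bexI[of _ "w + fscale c e"] ballI)
    show "w + fscale c e \<in> fun_space.span (insert a B)"
      using w sub e_span by (blast intro: fun_space.span_add fun_space.span_scale)
    fix b assume "b \<in> fun_space.span (insert a B)"
    then obtain k where k: "b - fscale k a \<in> fun_space.span B"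
      by (auto simp: fun_space.span_insert)
    define g where "g = b - fscale k e"
    have "g = (b - fscale k a) + fscale k u"
      by (auto simp: g_def e_def fun_eq_iff fscale_apply algebra_simps)
    then have g: "g \<in> fun_space.span B"
      using k u by (metis fun_space.span_add fun_space.span_scale)
    have b_eq: "b x = g x + k * e x" for x
      by (simp add: g_def fscale_apply)
    have "(\<Sum>x\<in>S. (f x - (w + fscale c e) x) * b x) =
        (\<Sum>x\<in>S. (f x - w x) * g x) - c * (\<Sum>x\<in>S. e x * g x)
        + k * ((\<Sum>x\<in>S. (f x - w x) * e x) - c * (\<Sum>x\<in>S. e x * e x))"
      by (simp add: b_eq fscale_apply algebra_simps sum.distrib sum_subtractf sum_distrib_left)
    also have "\<dots> = 0"
      using w_orth[OF g] u_orth[OF g] c_eq by (simp add: e_def)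
    finally show "(\<Sum>x\<in>S. (f x - (w + fscale c e) x) * b x) = 0" .
  qed
qed

text \<open>
  First-order optimality for minimizing the sampled squared distance to v over the functions in V
  that agree with v at z; admissible variations are the members of V vanishing at z.
\<close>

definition lsq_normal_equations ::
  "('a \<Rightarrow> real) set \<Rightarrow> 'a set \<Rightarrow> 'a \<Rightarrow> ('a \<Rightarrow> real) \<Rightarrow> ('a \<Rightarrow> real) \<Rightarrow> bool" where
  "lsq_normal_equations V S z v p \<longleftrightarrow>
     p \<in> V \<and> p z = v z \<and> (\<forall>q\<in>V. q z = 0 \<longrightarrow> (\<Sum>x\<in>S. (p x - v x) * q x) = 0)"

lemma lsq_normal_equations_add:
  assumes V: "fun_space.subspace V"
    and "lsq_normal_equations V S z u p" "lsq_normal_equations V S z v q"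
  shows "lsq_normal_equations V S z (u + v) (p + q)"
proof -
  have "(\<Sum>x\<in>S. ((p + q) x - (u + v) x) * r x) =
      (\<Sum>x\<in>S. (p x - u x) * r x) + (\<Sum>x\<in>S. (q x - v x) * r x)" for r
    by (simp add: algebra_simps sum.distrib sum_subtractf)
  then show ?thesis
    using assms fun_space.subspace_add[OF V] by (simp add: lsq_normal_equations_def)
qed

lemma lsq_normal_equations_scale:
  assumes V: "fun_space.subspace V" and "lsq_normal_equations V S z v p"
  shows "lsq_normal_equations V S z (fscale c v) (fscale c p)"
proof -
  have "(\<Sum>x\<in>S. (fscale c p x - fscale c v x) * r x) = c * (\<Sum>x\<in>S. (p x - v x) * r x)" for r
    by (simp add: fscale_apply algebra_simps sum_subtractf sum_distrib_left)
  moreover have "fscale c p \<in> V"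
    using assms(2) fun_space.subspace_scale[OF V] by (simp add: lsq_normal_equations_def)
  ultimately show ?thesis
    using assms(2) by (simp add: lsq_normal_equations_def fscale_apply)
qed

text \<open>
  A function e of V with e z = 1 makes the constraint satisfiable; subtracting the right multiple
  of it leaves an unconstrained projection onto the members of V that vanish at z.
\<close>

lemma lsq_normal_equations_solvable:
  fixes V :: "('a \<Rightarrow> real) set"
  assumes V: "fun_space.subspace V" and fin: "finite F" "V \<subseteq> fun_space.span F"
    and S: "finite S" and e: "e \<in> V" "e z = 1"
  shows "\<exists>p. lsq_normal_equations V S z v p"
proof -
  define W where "W = {q \<in> V. q z = 0}"
  have W: "fun_space.subspace W"
    using V unfolding W_def fun_space.subspace_def by (auto simp: fscale_apply)
  obtain B where B: "B \<subseteq> W" "fun_space.independent B" "W \<subseteq> fun_space.span B"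
    using fun_space.maximal_independent_subset by blast
  have "finite B"
    using fun_space.independent_span_bound[OF fin(1) B(2)] B(1) fin(2) by (auto simp: W_def)
  then obtain w where w: "w \<in> fun_space.span B" and
    w_orth: "\<And>b. b \<in> fun_space.span B \<Longrightarrow> (\<Sum>x\<in>S. ((v - fscale (v z) e) x - w x) * b x) = 0"
    using sampled_projection_exists[OF S, of B "v - fscale (v z) e"] by blast
  have "w \<in> W"
    using w B(1) W fun_space.span_minimal by blast
  then have w_V: "w \<in> V" "w z = 0" by (auto simp: W_def)
  define p where "p = fscale (v z) e + w"
  have "(\<Sum>x\<in>S. (p x - v x) * q x) = 0" if "q \<in> V" "q z = 0" for q
  proof -
    have "(\<Sum>x\<in>S. (p x - v x) * q x) = - (\<Sum>x\<in>S. ((v - fscale (v z) e) x - w x) * q x)"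
      unfolding sum_negf[symmetric] by (rule sum.cong) (simp_all add: p_def fscale_apply algebra_simps)
    also have "\<dots> = 0"
      using w_orth[of q] B(3) that by (auto simp: W_def)
    finally show ?thesis .
  qed
  moreover have "p \<in> V"
    unfolding p_def using V e(1) w_V(1)
    by (blast intro: fun_space.subspace_add fun_space.subspace_scale)
  moreover have "p z = v z"
    using e(2) w_V(2) by (simp add: p_def fscale_apply)
  ultimately show ?thesis
    by (auto simp: lsq_normal_equations_def)
qed

text \<open>
  By Pythagoras, any competitor exceeds the value at p by the sampled square of its distance to p.
  A second minimizer therefore agrees with p at the samples, hence everywhere.
\<close>

lemma the_arg_min_eq_solution:
  fixes V :: "('a \<Rightarrow> real) set"
  assumes V: "fun_space.subspace V" and S: "finite S"
    and unisolvent: "\<And>q. q \<in> V \<Longrightarrow> \<forall>x\<in>S. q x = 0 \<Longrightarrow> q = 0"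
    and p: "lsq_normal_equations V S z v p"
  shows "(THE p. is_arg_min (\<lambda>q. \<Sum>x\<in>S. (q x - v x)\<^sup>2) (\<lambda>q. q \<in> V \<and> q z = v z) p) = p"
proof -
  let ?J = "\<lambda>q. \<Sum>x\<in>S. (q x - v x)\<^sup>2"
  let ?P = "\<lambda>q. q \<in> V \<and> q z = v z"
  have p_feasible: "?P p"
    using p by (simp add: lsq_normal_equations_def)
  have pythagoras: "?J q = ?J p + (\<Sum>x\<in>S. (q x - p x)\<^sup>2)" if q: "?P q" for q
  proof -
    have "q - p \<in> V" "(q - p) z = 0"
      using fun_space.subspace_diff[OF V] q p_feasible by auto
    then have orth: "(\<Sum>x\<in>S. (p x - v x) * (q x - p x)) = 0"
      using p by (auto simp: lsq_normal_equations_def)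
    have "?J q = ?J p + (\<Sum>x\<in>S. (q x - p x)\<^sup>2) + 2 * (\<Sum>x\<in>S. (p x - v x) * (q x - p x))"
      unfolding sum_distrib_left sum.distrib[symmetric]
      by (rule sum.cong) (simp_all add: power2_eq_square algebra_simps)
    then show ?thesis using orth by simp
  qed
  show ?thesis
  proof (rule the_equality)
    have "?J p \<le> ?J q" if "?P q" for q
      unfolding pythagoras[OF that] by (simp add: sum_nonneg)
    then show "is_arg_min ?J ?P p"
      unfolding is_arg_min_def using p_feasible by (meson not_less)
    fix q assume q: "is_arg_min ?J ?P q"
    then have "?P q" "\<not> ?J p < ?J q"
      using p_feasible unfolding is_arg_min_def by blast+
    then have "(\<Sum>x\<in>S. (q x - p x)\<^sup>2) \<le> 0"
      using pythagoras[of q] by linarith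
    then have "(\<Sum>x\<in>S. (q x - p x)\<^sup>2) = 0"
      by (intro antisym sum_nonneg) auto
    then have "\<forall>x\<in>S. (q - p) x = 0"
      using S by (simp add: sum_nonneg_eq_0_iff)
    then have "q - p = 0"
      using unisolvent fun_space.subspace_diff[OF V] \<open>?P q\<close> p_feasible by blast
    then show "q = p" by simp
  qed
qed

section \<open>Polynomials of bounded degree\<close>

lemma finite_multi_indices: "finite {\<alpha> :: 'd::finite \<Rightarrow> nat. (\<Sum>i\<in>UNIV. \<alpha> i) \<le> m}"
proof (rule finite_subset)
  have "\<alpha> i \<le> m" if "(\<Sum>i\<in>UNIV. \<alpha> i) \<le> m" for \<alpha> :: "'d \<Rightarrow> nat" and i
    using member_le_sum[of i UNIV \<alpha>] that by simp
  then show "{\<alpha> :: 'd \<Rightarrow> nat. (\<Sum>i\<in>UNIV. \<alpha> i) \<le> m} \<subseteq> (\<Pi>\<^sub>E i\<in>UNIV. {..m})"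
    by (auto simp: PiE_UNIV_domain)
  show "finite (\<Pi>\<^sub>E i\<in>(UNIV :: 'd set). {..m})"
    by (rule finite_PiE) auto
qed

lemma subspace_polys_on:
  fixes D :: "(real ^ 'd) set"
  shows "fun_space.subspace (polys_on m D)"
proof (rule fun_space.subspaceI)
  show "0 \<in> polys_on m D"
    unfolding polys_on_def by (auto intro!: exI[of _ "\<lambda>_. 0"])
next
  fix p q assume "p \<in> polys_on m D" "q \<in> polys_on m D"
  then obtain b c where
    "p = (\<lambda>x. if x \<in> D then \<Sum>\<alpha> | (\<Sum>i\<in>UNIV. \<alpha> i) \<le> m. b \<alpha> * (\<Prod>i\<in>UNIV. (x $ i) ^ \<alpha> i) else 0)"
    "q = (\<lambda>x. if x \<in> D then \<Sum>\<alpha> | (\<Sum>i\<in>UNIV. \<alpha> i) \<le> m. c \<alpha> * (\<Prod>i\<in>UNIV. (x $ i) ^ \<alpha> i) else 0)"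
    unfolding polys_on_def by blast
  then show "p + q \<in> polys_on m D"
    unfolding polys_on_def
    by (auto intro!: exI[of _ "\<lambda>\<alpha>. b \<alpha> + c \<alpha>"] simp: fun_eq_iff distrib_right sum.distrib)
next
  fix k :: real and p assume "p \<in> polys_on m D"
  then obtain c where
    "p = (\<lambda>x. if x \<in> D then \<Sum>\<alpha> | (\<Sum>i\<in>UNIV. \<alpha> i) \<le> m. c \<alpha> * (\<Prod>i\<in>UNIV. (x $ i) ^ \<alpha> i) else 0)"
    unfolding polys_on_def by blast
  then show "fscale k p \<in> polys_on m D"
    unfolding polys_on_def
    by (auto intro!: exI[of _ "\<lambda>\<alpha>. k * c \<alpha>"] simp: fun_eq_iff fscale_apply sum_distrib_left mult.assoc)
qed

lemma polys_on_finitely_spanned: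
  fixes D :: "(real ^ 'd) set"
  shows "\<exists>F. finite F \<and> polys_on m D \<subseteq> fun_space.span F"
proof -
  let ?A = "{\<alpha> :: 'd \<Rightarrow> nat. (\<Sum>i\<in>UNIV. \<alpha> i) \<le> m}"
  define mono where
    "mono = (\<lambda>(\<alpha> :: 'd \<Rightarrow> nat) x. if x \<in> D then \<Prod>i\<in>UNIV. (x $ i) ^ \<alpha> i else 0 :: real)"
  have "p \<in> fun_space.span (mono ` ?A)" if "p \<in> polys_on m D" for p
  proof -
    obtain c where c: "p = (\<lambda>x. if x \<in> D
        then \<Sum>\<alpha>\<in>?A. c \<alpha> * (\<Prod>i\<in>UNIV. (x $ i) ^ \<alpha> i) else 0)"
      using \<open>p \<in> polys_on m D\<close> unfolding polys_on_def by blast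
    have sum_apply: "(\<Sum>\<alpha>\<in>A. f \<alpha>) x = (\<Sum>\<alpha>\<in>A. f \<alpha> x)"
      if "finite A" for A and f :: "('d \<Rightarrow> nat) \<Rightarrow> real ^ 'd \<Rightarrow> real" and x
      using that by induction auto
    have "p = (\<Sum>\<alpha>\<in>?A. fscale (c \<alpha>) (mono \<alpha>))"
      by (rule ext) (simp add: c mono_def fscale_apply sum_apply finite_multi_indices)
    also have "\<dots> \<in> fun_space.span (mono ` ?A)"
      by (intro fun_space.span_sum fun_space.span_scale fun_space.span_base) auto
    finally show ?thesis .
  qed
  then show ?thesis
    using finite_multi_indices by blast
qed

lemma one_in_polys_on:
  fixes D :: "(real ^ 'd) set"
  shows "(\<lambda>x. if x \<in> D then 1 else 0) \<in> polys_on m D"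
proof -
  have "(\<Sum>\<alpha> | (\<Sum>i\<in>UNIV. \<alpha> i) \<le> m.
      (if \<alpha> = (\<lambda>_. 0) then 1 else 0) * (\<Prod>i\<in>UNIV. (x $ i) ^ \<alpha> i)) = 1" for x :: "real ^ 'd"
    using finite_multi_indices[where 'd = 'd, of m]
    by (subst sum.remove[of _ "\<lambda>_. 0"]) (auto intro!: sum.neutral)
  then show ?thesis
    unfolding polys_on_def
    by (intro CollectI exI[of _ "\<lambda>\<alpha>. if \<alpha> = (\<lambda>_. 0) then 1 else 0"]) (auto simp: fun_eq_iff)
qed

section \<open>Meshes, barycenters and patches\<close>

lemma barycenter_in_interior_simplex:
  fixes K :: "'a::euclidean_space set"
  assumes "int DIM('a) simplex K"
  shows "barycenter K \<in> interior K"
proof -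
  obtain A where A: "\<not> affine_dependent A" "int (card A) = int DIM('a) + 1" "K = convex hull A"
    using assms by (auto simp: simplex_def)
  have "{v. v extreme_point_of K} = A"
    using A by (simp add: extreme_point_of_convex_hull_affine_independent)
  then have "barycenter K = (\<Sum>v\<in>A. (1 / real (card A)) *\<^sub>R v)"
    by (simp add: barycenter_def scaleR_sum_right divide_inverse)
  moreover have "card A > DIM('a)"
    using A(2) by simp
  moreover from this have "(\<Sum>v\<in>A. 1 / real (card A)) = 1"
    by simp
  ultimately show ?thesis
    unfolding A(3) interior_convex_hull_explicit_minimal[OF A(1)]
    by (auto intro!: exI[of _ "\<lambda>_. 1 / real (card A)"])
qed

text \<open>
  Two elements meet in a common face, and a proper face of an element misses its interior.
\<close>

lemma triangulation_interiors_disjoint: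
  assumes "triangulation T" "K \<in> T" "L \<in> T" "x \<in> interior K" "x \<in> interior L"
  shows "K = L"
proof -
  have face: "K \<inter> L face_of K" "L \<inter> K face_of L"
    using assms(1-3) by (auto simp: triangulation_def)
  have "x \<in> K \<inter> L"
    using assms(4,5) interior_subset by blast
  then have "K \<inter> L = K" "L \<inter> K = L"
    using face_of_disjoint_interior[OF face(1)] face_of_disjoint_interior[OF face(2)] assms(4,5)
    by blast+
  then show ?thesis by blast
qed

lemma layers_subset: "K \<in> T \<Longrightarrow> layers T K t \<subseteq> T"
  by (induction t) (auto simp: neighbours_def)

lemma center_in_layers:
  assumes "K \<in> T" "K \<noteq> {}"
  shows "K \<in> layers T K t"
  using assms by (induction t) (auto simp: neighbours_def)

section \<open>The reconstruction operator\<close>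

text \<open>
  Unisolvence makes every local least squares problem uniquely solvable. That the elements are
  full-dimensional simplices meeting in common faces puts each barycenter in the interior of its
  own element and of no other, so that the reconstruction evaluated there is the local one.
\<close>

locale reconstruction_mesh =
  fixes T :: "(real ^ 'd) set set" and N :: int and m :: nat
  assumes triangulation: "triangulation T"
    and full_dim: "K \<in> T \<Longrightarrow> int DIM(real ^ 'd) simplex K"
    and unisolvent: "\<lbrakk>K \<in> T; p \<in> polys_on m (\<Union>(patch T N K)); \<forall>x\<in>sample_points T N K. p x = 0\<rbrakk>
           \<Longrightarrow> p = 0"
begin

lemma barycenter_in_interior: "K \<in> T \<Longrightarrow> barycenter K \<in> interior K"
  using full_dim barycenter_in_interior_simplex by blast

lemma element_at: "\<lbrakk>K \<in> T; x \<in> interior K\<rbrakk> \<Longrightarrow> (THE K. K \<in> T \<and> x \<in> interior K) = K"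
  by (intro the_equality) (auto dest: triangulation_interiors_disjoint[OF triangulation])

lemma barycenter_in_patch:
  assumes "K \<in> T"
  shows "barycenter K \<in> \<Union>(patch T N K)"
proof -
  have "barycenter K \<in> K"
    using barycenter_in_interior[OF assms] interior_subset by blast
  moreover from this have "K \<in> patch T N K"
    unfolding patch_def using center_in_layers[OF assms] by blast
  ultimately show ?thesis by blast
qed

lemma finite_sample_points:
  assumes "K \<in> T"
  shows "finite (sample_points T N K)"
proof -
  have "finite T"
    using triangulation by (simp add: triangulation_def)
  then show ?thesis
    unfolding sample_points_def patch_def
    using finite_subset[OF layers_subset[OF assms]] by blast
qed

abbreviation is_local_solution where
  "is_local_solution K \<equiv>
     lsq_normal_equations (polys_on m (\<Union>(patch T N K))) (sample_points T N K) (barycenter K)"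

lemma local_recon_eqI:
  assumes "K \<in> T" "is_local_solution K v p"
  shows "local_recon T N m K v = p"
  unfolding local_recon_def
  using the_arg_min_eq_solution[OF subspace_polys_on finite_sample_points[OF assms(1)]
      unisolvent[OF assms(1)] assms(2)] .

lemma local_recon_solution:
  assumes "K \<in> T"
  shows "is_local_solution K v (local_recon T N m K v)"
proof -
  obtain F where F: "finite F" "polys_on m (\<Union>(patch T N K)) \<subseteq> fun_space.span F"
    using polys_on_finitely_spanned by blast
  obtain p where p: "is_local_solution K v p"
    using lsq_normal_equations_solvable[OF subspace_polys_on F finite_sample_points[OF assms]
        one_in_polys_on, of "barycenter K" v]
      barycenter_in_patch[OF assms] by auto
  then show ?thesis
    unfolding local_recon_eqI[OF assms p] .
qed

lemma local_recon_add:
  "K \<in> T \<Longrightarrow> local_recon T N m K (u + v) = local_recon T N m K u + local_recon T N m K v"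
  by (intro local_recon_eqI lsq_normal_equations_add subspace_polys_on local_recon_solution)

lemma local_recon_scale:
  "K \<in> T \<Longrightarrow> local_recon T N m K (fscale c v) = fscale c (local_recon T N m K v)"
  by (intro local_recon_eqI lsq_normal_equations_scale subspace_polys_on local_recon_solution)

lemma recon_on_element:
  "\<lbrakk>K \<in> T; x \<in> interior K\<rbrakk> \<Longrightarrow> recon T N m v x = local_recon T N m K v x"
  by (auto simp: recon_def element_at)

lemma recon_off_elements: "x \<notin> (\<Union>K\<in>T. interior K) \<Longrightarrow> recon T N m v x = 0"
  by (simp add: recon_def)

lemma linear_recon: "Vector_Spaces.linear fscale fscale (recon T N m)"
proof (unfold Vector_Spaces.linear_iff, intro conjI allI)
  fix u v and c :: real
  show "recon T N m (u + v) = recon T N m u + recon T N m v"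
  proof
    fix x
    show "recon T N m (u + v) x = (recon T N m u + recon T N m v) x"
      by (cases "x \<in> (\<Union>K\<in>T. interior K)")
        (auto simp: recon_on_element local_recon_add recon_off_elements)
  qed
  show "recon T N m (fscale c v) = fscale c (recon T N m v)"
  proof
    fix x
    show "recon T N m (fscale c v) x = fscale c (recon T N m v) x"
      by (cases "x \<in> (\<Union>K\<in>T. interior K)")
        (auto simp: fscale_apply recon_on_element local_recon_scale recon_off_elements)
  qed
qed (rule fun_space.vector_space_axioms)+

lemma recon_at_barycenter: "K \<in> T \<Longrightarrow> recon T N m v (barycenter K) = v (barycenter K)"
  using local_recon_solution[of K v]
  by (simp add: recon_on_element barycenter_in_interior lsq_normal_equations_def)

lemma pw_const_eqI:
  assumes "u \<in> pw_const T" "v \<in> pw_const T"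
    and "\<And>K. K \<in> T \<Longrightarrow> u (barycenter K) = v (barycenter K)"
  shows "u = v"
proof
  fix x
  show "u x = v x"
  proof (cases "x \<in> (\<Union>K\<in>T. interior K)")
    case True
    then obtain K where K: "K \<in> T" "x \<in> interior K" by blast
    then have "u x = u (barycenter K)" "v x = v (barycenter K)"
      using assms(1,2) barycenter_in_interior[OF K(1)]
      unfolding pw_const_def constant_on_def by auto
    then show ?thesis using assms(3)[OF K(1)] by simp
  next
    case False
    then show ?thesis using assms(1,2) by (simp add: pw_const_def)
  qed
qed

lemma inj_on_recon: "inj_on (recon T N m) (pw_const T)"
  by (intro inj_onI pw_const_eqI) (assumption, assumption, metis recon_at_barycenter)

end

lemma subspace_pw_const: "fun_space.subspace (pw_const T)"
proof (rule fun_space.subspaceI)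
  show "0 \<in> pw_const T"
    by (auto simp: pw_const_def constant_on_def)
next
  fix u v assume "u \<in> pw_const T" "v \<in> pw_const T"
  then show "u + v \<in> pw_const T"
    unfolding pw_const_def constant_on_def by simp metis
next
  fix c :: real and v assume "v \<in> pw_const T"
  then show "fscale c v \<in> pw_const T"
    unfolding pw_const_def constant_on_def by (simp add: fscale_apply) metis
qed

text \<open>
  The whole function space is infinite-dimensional, so the comparison of dimensions is made
  on a basis of V.
\<close>

lemma dim_injective_linear_image:
  assumes f: "Vector_Spaces.linear fscale fscale f"
    and V: "fun_space.subspace V" and inj: "inj_on f V"
  shows "fun_space.dim (f ` V) = fun_space.dim V"
proof -
  interpret f: Vector_Spaces.linear fscale fscale f by (rule f)
  obtain B where B: "B \<subseteq> V" "fun_space.independent B" "V \<subseteq> fun_space.span B"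
      "card B = fun_space.dim V"
    using fun_space.basis_exists by blast
  have span_B: "fun_space.span B = V"
    using B(1,3) V fun_space.span_minimal by blast
  have "fun_space.independent (f ` B)"
    using f.independent_inj_on_image[OF B(2)] inj span_B by simp
  moreover have "fun_space.span (f ` B) = fun_space.span (f ` V)"
    by (metis f.span_image fun_space.span_span span_B)
  ultimately have "fun_space.dim (f ` V) = card (f ` B)"
    using fun_space.dim_eq_card by blast
  also have "\<dots> = card B"
    by (rule card_image[OF inj_on_subset[OF inj B(1)]])
  finally show ?thesis using B(4) by simp
qed

theorem lemma2:
  fixes \<Omega> :: "(real ^ 'd) set" and T :: "(real ^ 'd) set set"
    and C\<^sub>\<sigma> :: real and N :: int and m :: nat
  assumes "CARD('d) = 2 \<or> CARD('d) = 3"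
    and "convex_polyhedral_domain \<Omega>"
    and "simplicial_mesh \<Omega> T"
    and "C\<^sub>\<sigma> > 0" and "quasi_uniform C\<^sub>\<sigma> T"
    and "\<And>K. K \<in> T \<Longrightarrow> \<exists>t. N \<le> int (card (layers T K t))"
    and "\<And>K p. \<lbrakk>K \<in> T; p \<in> polys_on m (\<Union>(patch T N K)); \<forall>x\<in>sample_points T N K. p x = 0\<rbrakk>
           \<Longrightarrow> p = 0"
    and "m \<ge> 1"
  shows "(\<forall>u\<in>pw_const T. \<forall>v\<in>pw_const T. recon T N m (u + v) = recon T N m u + recon T N m v)
       \<and> (\<forall>c. \<forall>v\<in>pw_const T. recon T N m (fscale c v) = fscale c (recon T N m v))
       \<and> fun_space.dim (recon T N m ` pw_const T) = fun_space.dim (pw_const T)"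
proof -
  interpret reconstruction_mesh T N m
    using assms(3,7) by unfold_locales (auto simp: simplicial_mesh_def)
  interpret recon: Vector_Spaces.linear fscale fscale "recon T N m"
    by (rule linear_recon)
  show ?thesis
    using recon.add recon.scale
      dim_injective_linear_image[OF linear_recon subspace_pw_const inj_on_recon]
    by blast
qed

end
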